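(* Let $n=5k$ with $k\ge 2$ even (so $n$ is a positive multiple of $10$). Let $\pi\colon\{1,\dots,n\}\to\{1,\dots,n\}$ be the permutation given, for each $0\le i\le k-1$, by $$\pi(5i+1)=5i+2,\quad \pi(5i+2)=5i+4,\quad \pi(5i+3)=5i+1,\quad \pi(5i+4)=5i+5,\quad \pi(5i+5)=5i+3.$$ Let $\mathcal{P}_{\mathrm{id}}$ be a convex set of $n$ points labeled $(1,2,\dots,n)$ in clockwise order, and let $\mathcal{P}_\pi$ be a convex set of $n$ points labeled $(\pi(1),\pi(2),\dots,\pi(n))$ in clockwise order. Then the largest compatible matching of $\mathcal{P}_{\mathrm{id}}$ and $\mathcal{P}_\pi$ contains exactly $\frac{2}{5}n$ edges.
   Context: A convex set of points is a finite set of points in the plane in (strictly) convex position. A matching is a set of pairwise disjoint 2-element subsets (edges) of the label set $\{1,\dots,n\}$. It is compatible to several labeled point sets if, on each of them, its straight-line drawing (edge $\{a,b\}$ drawn as the segment between the points labeled $a$ and $b$) is crossing-free. *)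

theory Defs
  imports "HOL-Analysis.Analysis"
begin

definition convex_position :: "(real^2) set \<Rightarrow> bool" where
  "convex_position S \<longleftrightarrow> finite S \<and> (\<forall>x\<in>S. x extreme_point_of (convex hull S))"

(* The formula is twice the signed area of the triangle a b c, which is negative
   exactly if the triangle is traversed clockwise. *)
definition clockwise_turn :: "real^2 \<Rightarrow> real^2 \<Rightarrow> real^2 \<Rightarrow> bool" where
  "clockwise_turn a b c \<longleftrightarrow>
     (b $ 1 - a $ 1) * (c $ 2 - a $ 2) - (b $ 2 - a $ 2) * (c $ 1 - a $ 1) < 0"

(* p maps each label in {1..n} to its point; \<sigma> 1, ..., \<sigma> n are the labels met in
   clockwise order around the convex hull.  For points in convex position, a cyclic
   sequence is in clockwise order iff all its increasing triples turn clockwise. *)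
definition clockwise_labeled_convex_set ::
    "nat \<Rightarrow> (nat \<Rightarrow> nat) \<Rightarrow> (nat \<Rightarrow> real^2) \<Rightarrow> bool" where
  "clockwise_labeled_convex_set n \<sigma> p \<longleftrightarrow>
     inj_on p {1..n} \<and> convex_position (p ` {1..n}) \<and>
     (\<forall>i j l. 1 \<le> i \<and> i < j \<and> j < l \<and> l \<le> n \<longrightarrow>
        clockwise_turn (p (\<sigma> i)) (p (\<sigma> j)) (p (\<sigma> l)))"

definition matching :: "nat \<Rightarrow> nat set set \<Rightarrow> bool" where
  "matching n M \<longleftrightarrow> (\<forall>e\<in>M. e \<subseteq> {1..n} \<and> card e = 2) \<and> pairwise disjnt M"

(* Segments may meet only in the point of a shared label, so for a matching the
   segments of distinct edges are disjoint. *)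
definition crossing_free :: "(nat \<Rightarrow> real^2) \<Rightarrow> nat set set \<Rightarrow> bool" where
  "crossing_free p M \<longleftrightarrow>
     (\<forall>a b c d. {a, b} \<in> M \<and> {c, d} \<in> M \<and> {a, b} \<noteq> {c, d} \<longrightarrow>
        closed_segment (p a) (p b) \<inter> closed_segment (p c) (p d) \<subseteq> p ` ({a, b} \<inter> {c, d}))"

definition compatible_matching ::
    "nat \<Rightarrow> (nat \<Rightarrow> real^2) set \<Rightarrow> nat set set \<Rightarrow> bool" where
  "compatible_matching n \<P> M \<longleftrightarrow> matching n M \<and> (\<forall>p\<in>\<P>. crossing_free p M)"

end

theory Submission
  imports Defs
begin

text \<open>
  Cut the labels into the \<open>k\<close> blocks \<open>{5i+1, \<dots>, 5i+5}\<close>, which are contiguous in both cyclic orders.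
  The edges \<open>{5i+2, 5i+3}\<close> and \<open>{5i+4, 5i+5}\<close> give a compatible matching with \<open>2k\<close> edges.
  Conversely every block has an unmatched label.  In a fully matched block, all labels strictly
  between the ends of an edge inside the block are matched among themselves, in both orders, and
  this excludes such edges.  If all five labels are matched to the outside, their partners
  appear in reverse in both orders; comparing blocks, all partners lie in one single block, and
  then the two orders reversed by the matching are those of that block, which is impossible.
\<close>

subsection \<open>Segments between points in convex position\<close>

text \<open>The determinant tested by \<open>clockwise_turn\<close>, kept as a real number: the
  proofs use its affine dependence on the third point, not only its sign.\<close>

definition orient :: "real^2 \<Rightarrow> real^2 \<Rightarrow> real^2 \<Rightarrow> real" where
  "orient a b c = (b $ 1 - a $ 1) * (c $ 2 - a $ 2) - (b $ 2 - a $ 2) * (c $ 1 - a $ 1)"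

lemma clockwise_turn_orient: "clockwise_turn a b c \<longleftrightarrow> orient a b c < 0"
  by (simp add: clockwise_turn_def orient_def)

lemma orient_rotate: "orient a b c = orient b c a"
  by (simp add: orient_def algebra_simps)

lemma orient_affine:
  "orient a b ((1 - u) *\<^sub>R c + u *\<^sub>R d) = (1 - u) * orient a b c + u * orient a b d"
  by (simp add: orient_def algebra_simps)

lemma orient_closed_segment_eq_0:
  assumes "x \<in> closed_segment a b"
  shows "orient a b x = 0"
proof -
  obtain u where "x = (1 - u) *\<^sub>R a + u *\<^sub>R b"
    using assms by (auto simp: closed_segment_def)
  then show ?thesis
    by (simp only: orient_affine) (simp add: orient_def)
qed

lemma orient_closed_segment_neg:
  assumes "x \<in> closed_segment c d" "orient a b c < 0" "orient a b d < 0"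
  shows "orient a b x < 0"
proof -
  obtain u where u: "0 \<le> u" "u \<le> 1" and x: "x = (1 - u) *\<^sub>R c + u *\<^sub>R d"
    using assms by (auto simp: closed_segment_def)
  show ?thesis unfolding x orient_affine
    by (rule convex_bound_lt[OF assms(2,3)]) (use u in auto)
qed

text \<open>The line through \<open>a\<close> and \<open>b\<close> separates:
  \<open>orient a b\<close> vanishes on the first segment and, being affine, stays negative on the
  second.\<close>

lemma orient_neg_disjoint_segments:
  assumes "orient a b c < 0" "orient a b d < 0"
  shows "closed_segment a b \<inter> closed_segment c d = {}"
  using orient_closed_segment_eq_0[of _ a b] orient_closed_segment_neg[OF _ assms] by fastforce

text \<open>Four points of the plane satisfy an affine dependence whose coefficients are, up to sign
  and scale, the areas of the triangles omitting one point each. Here \<open>b\<close> and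
  \<open>d\<close> balance \<open>a\<close> and \<open>c\<close>; dividing by the total weight gives
  the common point.\<close>

lemma convex_quadrilateral_diagonals_meet:
  assumes "orient a b c < 0" "orient a b d < 0" "orient a c d < 0" "orient b c d < 0"
  shows "closed_segment a c \<inter> closed_segment b d \<noteq> {}"
proof -
  define s t v w where "s = - orient a b c" and "t = - orient a c d"
    and "v = - orient b c d" and "w = - orient a b d"
  note defs = s_def t_def v_def w_def
  have pos: "s > 0" "t > 0" "v > 0" "w > 0"
    using assms by (auto simp: defs)
  have sum: "s + t = v + w"
    by (simp add: defs orient_def algebra_simps)
  have *: "s *\<^sub>R d + t *\<^sub>R b = v *\<^sub>R a + w *\<^sub>R c"
    by (simp add: vec_eq_iff forall_2 defs orient_def algebra_simps)
  have eq: "(1 - s / (s + t)) *\<^sub>R b + (s / (s + t)) *\<^sub>R d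
      = (1 - w / (v + w)) *\<^sub>R a + (w / (v + w)) *\<^sub>R c"
  proof -
    have "1 - s / (s + t) = t / (s + t)" "1 - w / (v + w) = v / (v + w)"
      using pos by (simp_all add: field_simps)
    then have "(1 - s / (s + t)) *\<^sub>R b + (s / (s + t)) *\<^sub>R d
        = inverse (s + t) *\<^sub>R (s *\<^sub>R d + t *\<^sub>R b)"
      "(1 - w / (v + w)) *\<^sub>R a + (w / (v + w)) *\<^sub>R c
        = inverse (v + w) *\<^sub>R (v *\<^sub>R a + w *\<^sub>R c)"
      by (simp_all add: scaleR_add_right divide_inverse mult.commute)
    then show ?thesis by (simp add: * sum)
  qed
  have "(1 - s / (s + t)) *\<^sub>R b + (s / (s + t)) *\<^sub>R d \<in> closed_segment b d"
    unfolding closed_segment_def using pos by (auto intro!: exI[of _ "s / (s + t)"])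
  moreover have "(1 - w / (v + w)) *\<^sub>R a + (w / (v + w)) *\<^sub>R c \<in> closed_segment a c"
    unfolding closed_segment_def using pos by (auto intro!: exI[of _ "w / (v + w)"])
  ultimately show ?thesis using eq by auto
qed

lemma matching_range: "matching n M \<Longrightarrow> {a, b} \<in> M \<Longrightarrow> a \<in> {1..n} \<and> b \<in> {1..n}"
  unfolding matching_def by (metis insert_subset)

section \<open>Crossings read off from cyclic positions\<close>

text \<open>Below, \<open>f x\<close> is the position of the label \<open>x\<close> in the cyclic order \<open>\<sigma>\<close>.\<close>

locale labeled_convex_set =
  fixes n :: nat and \<sigma> :: "nat \<Rightarrow> nat" and p :: "nat \<Rightarrow> real^2" and f :: "nat \<Rightarrow> nat"
  assumes clockwise: "clockwise_labeled_convex_set n \<sigma> p"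
    and position: "x \<in> {1..n} \<Longrightarrow> f x \<in> {1..n} \<and> \<sigma> (f x) = x"
begin

lemma orient_neg:
  assumes "x \<in> {1..n}" "y \<in> {1..n}" "z \<in> {1..n}" "f x < f y" "f y < f z"
  shows "orient (p x) (p y) (p z) < 0"
proof -
  have "clockwise_turn (p (\<sigma> (f x))) (p (\<sigma> (f y))) (p (\<sigma> (f z)))"
    using clockwise assms(4,5) position[OF assms(1)] position[OF assms(3)]
    unfolding clockwise_labeled_convex_set_def atLeastAtMost_iff by blast
  then show ?thesis
    using assms position by (simp add: clockwise_turn_orient)
qed

lemma segments_meet:
  assumes "a \<in> {1..n}" "b \<in> {1..n}" "c \<in> {1..n}" "d \<in> {1..n}"
    and "f a < f c" "f c < f b" "f b < f d"
  shows "closed_segment (p a) (p b) \<inter> closed_segment (p c) (p d) \<noteq> {}"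
  by (rule convex_quadrilateral_diagonals_meet) (use assms orient_neg in auto)

text \<open>A label before \<open>a\<close> or after \<open>b\<close> completes them to an
  increasing triple, up to rotation. So \<open>c\<close> and \<open>d\<close> lie on the same side
  of the line through \<open>p a\<close> and \<open>p b\<close>, even if one comes before and the
  other after.\<close>

lemma segments_disjoint_outside:
  assumes ran: "a \<in> {1..n}" "b \<in> {1..n}" "c \<in> {1..n}" "d \<in> {1..n}"
    and ab: "f a < f b" and out: "f c < f a \<or> f b < f c" "f d < f a \<or> f b < f d"
  shows "closed_segment (p a) (p b) \<inter> closed_segment (p c) (p d) = {}"
proof -
  have "orient (p a) (p b) (p z) < 0" if "z \<in> {1..n}" "f z < f a \<or> f b < f z" for z
    using that orient_neg[of z a b] orient_neg[of a b z] ran ab orient_rotate[of "p z"] by auto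
  then show ?thesis
    using ran out by (intro orient_neg_disjoint_segments) auto
qed

text \<open>Geometry ends here for the upper bound, which uses crossing-freeness only in this
  form.\<close>

lemma crossing_free_no_interleaving:
  assumes "crossing_free p M" "matching n M" "{a, b} \<in> M" "{c, d} \<in> M"
    and "f a < f c" "f c < f b"
  shows "\<not> f b < f d"
proof
  assume "f b < f d"
  have ran: "a \<in> {1..n}" "b \<in> {1..n}" "c \<in> {1..n}" "d \<in> {1..n}"
    using assms(3,4) matching_range[OF assms(2)] by simp_all
  have disj: "{a, b} \<inter> {c, d} = {}"
    using \<open>f b < f d\<close> assms(5,6) by auto
  then have "{a, b} \<noteq> {c, d}" by blast
  then have "closed_segment (p a) (p b) \<inter> closed_segment (p c) (p d) \<subseteq> p ` ({a, b} \<inter> {c, d})"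
    using assms unfolding crossing_free_def by blast
  then show False
    using segments_meet[OF ran assms(5,6) \<open>f b < f d\<close>] disj by simp
qed

end

subsection \<open>Blocks\<close>

text \<open>Labels start at \<open>1\<close>, hence the shift. Truncated subtraction also puts
  \<open>0\<close> into block \<open>0\<close>, so the bounds below assume
  \<open>x \<ge> 1\<close>.\<close>

definition block :: "nat \<Rightarrow> nat" where
  "block x = (x - 1) div 5"

text \<open>The inverse of \<open>\<pi>\<close>; the list entry at index \<open>0\<close> is a dummy.\<close>

definition pos :: "nat \<Rightarrow> nat" where
  "pos x = 5 * block x + [0, 3, 1, 5, 2, 4] ! (x - 5 * block x)"

lemma block_offset:
  assumes "r \<in> {1..5}"
  shows "block (5 * i + r) = i"
proof -
  have "5 * i + r - 1 = (r - 1) + 5 * i"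
    using assms by simp
  then show ?thesis
    unfolding block_def using assms by auto
qed

lemma block_simps:
  "block (5 * i + 1) = i" "block (5 * i + 2) = i" "block (5 * i + 3) = i"
  "block (5 * i + 4) = i" "block (5 * i + 5) = i"
  by (rule block_offset, simp)+

lemma pos_simps:
  "pos (5 * i + 1) = 5 * i + 3" "pos (5 * i + 2) = 5 * i + 1" "pos (5 * i + 3) = 5 * i + 5"
  "pos (5 * i + 4) = 5 * i + 2" "pos (5 * i + 5) = 5 * i + 4"
  unfolding pos_def block_simps by simp_all

lemma offset_cases:
  fixes i x :: nat
  assumes "5 * i < x" "x \<le> 5 * i + 5"
  obtains "x = 5 * i + 1" | "x = 5 * i + 2" | "x = 5 * i + 3" | "x = 5 * i + 4" | "x = 5 * i + 5"
  using assms by linarith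

lemma block_bounds:
  assumes "x \<ge> 1"
  shows "5 * block x < x" "x \<le> 5 * block x + 5"
  using assms div_mult_mod_eq[of "x - 1" 5] mod_less_divisor[of 5 "x - 1"]
  unfolding block_def by linarith+

lemma block_eqI:
  assumes "5 * i < x" "x \<le> 5 * i + 5"
  shows "block x = i"
  using assms by (cases rule: offset_cases) (simp_all only: block_simps)

lemma pos_bounds:
  assumes "x \<ge> 1"
  shows "5 * block x < pos x" "pos x \<le> 5 * block x + 5"
proof -
  have "5 * i < pos x \<and> pos x \<le> 5 * i + 5" if "5 * i < x" "x \<le> 5 * i + 5" for i
    using that by (cases rule: offset_cases) (simp_all only: pos_simps, auto)
  then show "5 * block x < pos x" "pos x \<le> 5 * block x + 5"
    using block_bounds[OF assms] by auto
qed

lemma pos_eq_iff: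
  assumes "x \<ge> 1" "y \<ge> 1"
  shows "pos x = pos y \<longleftrightarrow> x = y"
proof
  assume eq: "pos x = pos y"
  define i where "i = block x"
  \<comment> \<open>The common position determines the block; the 25 pairs of offsets are then
    checked one by one.\<close>
  have y: "block y = i"
    using pos_bounds[OF assms(1)] pos_bounds[OF assms(2)] eq unfolding i_def by linarith
  have bd: "5 * i < x" "x \<le> 5 * i + 5" "5 * i < y" "y \<le> 5 * i + 5"
    using block_bounds[OF assms(1)] block_bounds[OF assms(2)] y i_def by auto
  show "x = y"
    by (rule offset_cases[OF bd(1,2)]; rule offset_cases[OF bd(3,4)];
      use eq pos_simps[of i] in auto)
qed simp

subsection \<open>Fully matched blocks\<close>

text \<open>One pattern suffices: exchanging the ends of an edge, or the two edges, yields every way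
  to interleave.\<close>

definition noninterleaving :: "(nat \<Rightarrow> nat) \<Rightarrow> nat set set \<Rightarrow> bool" where
  "noninterleaving f M \<longleftrightarrow>
    (\<forall>a b c d. {a, b} \<in> M \<longrightarrow> {c, d} \<in> M \<longrightarrow> f a < f c \<longrightarrow> f c < f b \<longrightarrow> \<not> f b < f d)"

lemma noninterleavingD:
  assumes "noninterleaving f M" "{a, b} \<in> M" "{c, d} \<in> M"
  shows "\<not> (f a < f c \<and> f c < f b \<and> f b < f d)"
  using assms unfolding noninterleaving_def by blast

lemma matching_irrefl: "matching n M \<Longrightarrow> {a, a} \<notin> M"
  unfolding matching_def by fastforce

lemma matching_unique:
  assumes "matching n M" "{a, b} \<in> M" "{a, c} \<in> M"
  shows "b = c"
proof -
  have "pairwise disjnt M"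
    using assms(1) by (simp add: matching_def)
  then have "{a, b} = {a, c}"
    using assms(2,3) pairwiseD[of disjnt M "{a, b}" "{a, c}"] by (auto simp: disjnt_def)
  then show ?thesis by (metis doubleton_eq_iff)
qed

text \<open>What the two cyclic orders share, so that the arguments are made once for both
  \<open>id\<close> and \<open>pos\<close>.\<close>

locale block_order =
  fixes f :: "nat \<Rightarrow> nat"
  assumes bounds: "x \<ge> 1 \<Longrightarrow> 5 * block x < f x \<and> f x \<le> 5 * block x + 5"
    and eq_iff: "x \<ge> 1 \<Longrightarrow> y \<ge> 1 \<Longrightarrow> f x = f y \<longleftrightarrow> x = y"
begin

text \<open>\<open>w\<close> differs from \<open>x\<close> and \<open>y\<close> because a label has
  only one partner, and beyond either end it would make the edges interleave.\<close>

lemma partner_enclosed: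
  assumes M: "matching n M" "noninterleaving f M"
    and xy: "{x, y} \<in> M" and zw: "{z, w} \<in> M" and "f x < f z" "f z < f y"
  shows "f x < f w \<and> f w < f y"
proof -
  have ge1: "x \<ge> 1" "y \<ge> 1" "z \<ge> 1" "w \<ge> 1"
    using matching_range[OF M(1)] xy zw by auto
  have "w \<noteq> x" "w \<noteq> y"
    using matching_unique[OF M(1), of w] xy zw assms(5,6) by (metis insert_commute less_irrefl)+
  then have "f w \<noteq> f x" "f w \<noteq> f y"
    using eq_iff ge1 by auto
  moreover have "\<not> f y < f w"
    using noninterleavingD[OF M(2) xy zw] assms(5,6) by blast
  moreover have "\<not> f w < f x"
    using noninterleavingD[OF M(2), of w z x y] xy zw assms(5,6) by (simp add: insert_commute)
  ultimately show ?thesis by linarith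
qed

lemma partner_enclosed_block:
  assumes M: "matching n M" "noninterleaving f M"
    and xy: "{x, y} \<in> M" and zw: "{z, w} \<in> M" and "f x < f z" "f z < f y"
    and i: "block x = i" "block y = i"
  shows "f x < f w \<and> f w < f y \<and> 5 * i < w \<and> w \<le> 5 * i + 5"
proof -
  have ge1: "x \<ge> 1" "y \<ge> 1" "w \<ge> 1"
    using matching_range[OF M(1)] xy zw by auto
  have encl: "f x < f w \<and> f w < f y"
    by (rule partner_enclosed[OF assms(1-6)])
  then have "block w = i"
    using bounds[OF ge1(1)] bounds[OF ge1(2)] bounds[OF ge1(3)] i by linarith
  then show ?thesis
    using encl block_bounds[OF ge1(3)] by auto
qed

text \<open>
  The cyclic order is cut open just before block \<open>i\<close>, so labels in blocks before \<open>i\<close> are shifted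
  past the end.
\<close>

lemma partners_reversed:
  assumes M: "matching n M" "noninterleaving f M" and n: "n = 5 * k"
    and xa: "{x, a} \<in> M" and yb: "{y, b} \<in> M" and "f x < f y"
    and i: "block x = i" "block y = i" "block a \<noteq> i" "block b \<noteq> i"
  shows "f b + (if block b < i then n else 0) < f a + (if block a < i then n else 0)"
proof (rule ccontr)
  assume contr: "\<not> ?thesis"
  have ran: "x \<in> {1..n}" "y \<in> {1..n}" "a \<in> {1..n}" "b \<in> {1..n}"
    using matching_range[OF M(1)] xa yb by auto
  then have ge1: "x \<ge> 1" "y \<ge> 1" "a \<ge> 1" "b \<ge> 1" by auto
  have "block v < k" if "v \<in> {1..n}" for v
    using that block_bounds(1)[of v] n by auto
  then have le: "f a \<le> n" "f b \<le> n"
    using bounds[of a] bounds[of b] ran n by fastforce+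
  have "a \<noteq> b"
    using matching_unique[OF M(1), of a x y] xa yb \<open>f x < f y\<close> by (metis insert_commute less_irrefl)
  then have "f a \<noteq> f b"
    using eq_iff ge1 by auto
  note bd = bounds[OF ge1(1)] bounds[OF ge1(2)] bounds[OF ge1(3)] bounds[OF ge1(4)]
  note ni = noninterleavingD[OF M(2)]
  have M': "{a, x} \<in> M" "{b, y} \<in> M"
    using xa yb by (auto simp: insert_commute)
  \<comment> \<open>In the third case the shift alone decides the inequality; in the other three the
    two edges interleave.\<close>
  consider "i < block a" "i < block b" | "i < block a" "block b < i" | "block a < i" "i < block b"
    | "block a < i" "block b < i"
    using i by linarith
  then show False
  proof cases
    case 1
    then have "f x < f y \<and> f y < f a \<and> f a < f b"
      using contr bd i \<open>f x < f y\<close> \<open>f a \<noteq> f b\<close> by simp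
    then show ?thesis using ni[OF xa yb] by blast
  next
    case 2
    then have "f b < f x \<and> f x < f y \<and> f y < f a"
      using bd i \<open>f x < f y\<close> by linarith
    then show ?thesis using ni[OF M'(2) xa] by blast
  next
    case 3
    then show ?thesis using contr le bounds[OF ge1(3)] by simp
  next
    case 4
    then have "f a < f b \<and> f b < f x \<and> f x < f y"
      using contr bd i \<open>f x < f y\<close> \<open>f a \<noteq> f b\<close> by simp
    then show ?thesis using ni[OF M'] by blast
  qed
qed

end

interpretation id_order: block_order id
  by unfold_locales (auto simp: block_bounds)

interpretation pos_order: block_order pos
  by unfold_locales (auto simp: pos_bounds pos_eq_iff)

text \<open>The ten pairs of offsets are excluded in turn, each using only the enclosed labels and
  pairs excluded before.\<close>

lemma no_edge_inside_matched_block: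
  assumes M: "matching n M" "noninterleaving id M" "noninterleaving pos M"
    and full: "\<And>x. 5 * i < x \<Longrightarrow> x \<le> 5 * i + 5 \<Longrightarrow> \<exists>y. {x, y} \<in> M"
    and xy: "5 * i < x" "x \<le> 5 * i + 5" "5 * i < y" "y \<le> 5 * i + 5"
  shows "{x, y} \<notin> M"
proof -
  define E where "E r s \<longleftrightarrow> {5 * i + r, 5 * i + s} \<in> M" for r s
  have sym: "E r s \<longleftrightarrow> E s r" for r s
    by (simp add: E_def insert_commute)
  have irrefl: "\<not> E r r" for r
    using matching_irrefl[OF M(1)] by (simp add: E_def)
  have unique: "s = t" if "E r s" "E r t" for r s t
    using matching_unique[OF M(1)] that unfolding E_def by (metis add_left_cancel)
  have partner: "\<exists>u\<in>{1..5}. E t u \<and> f (5 * i + r) < f (5 * i + u) \<and> f (5 * i + u) < f (5 * i + s)"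
    if f: "block_order f" "noninterleaving f M" and E: "E r s"
      and ran: "r \<in> {1..5}" "s \<in> {1..5}" "t \<in> {1..5}"
      and less: "f (5 * i + r) < f (5 * i + t)" "f (5 * i + t) < f (5 * i + s)" for f r s t
  proof -
    interpret block_order f by fact
    obtain w where w: "{5 * i + t, w} \<in> M"
      using full[of "5 * i + t"] ran by auto
    have *: "f (5 * i + r) < f w \<and> f w < f (5 * i + s) \<and> 5 * i < w \<and> w \<le> 5 * i + 5"
      by (rule partner_enclosed_block[OF M(1) f(2) E[unfolded E_def] w less])
        (use ran in \<open>auto intro: block_offset\<close>)
    then have "w = 5 * i + (w - 5 * i)" "w - 5 * i \<in> {1..5}" by auto
    then show ?thesis
      using * w unfolding E_def by metis
  qed
  \<comment> \<open>The position inside the block: sorted by \<open>\<rho>\<close>, the offsets read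
    2, 4, 1, 5, 3. Index \<open>0\<close> is a dummy.\<close>
  define \<rho> where "\<rho> r = [0, 3, 1, 5, 2, 4 :: nat] ! r" for r :: nat
  have pos: "pos (5 * i + r) = 5 * i + \<rho> r" if "r \<in> {1..5}" for r
    using that block_offset[OF that] by (simp add: pos_def \<rho>_def)
  have id_partner: "\<exists>u\<in>{1..5}. E t u \<and> r < u \<and> u < s"
    if "E r s" "r \<in> {1..5}" "s \<in> {1..5}" "t \<in> {1..5}" "r < t" "t < s" for r s t
    using partner[OF id_order.block_order_axioms M(2) that(1-4)] that by simp
  have pos_partner: "\<exists>u\<in>{1..5}. E t u \<and> \<rho> r < \<rho> u \<and> \<rho> u < \<rho> s"
    if "E r s" "r \<in> {1..5}" "s \<in> {1..5}" "t \<in> {1..5}" "\<rho> r < \<rho> t" "\<rho> t < \<rho> s" for r s t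
    using partner[OF pos_order.block_order_axioms M(3) that(1-4)] that pos by fastforce
  have five: "{1..5} = {1, 2, 3, 4, 5 :: nat}" by auto
  have \<rho>: "\<rho> 1 = 3" "\<rho> (Suc 0) = 3" "\<rho> 2 = 1" "\<rho> 3 = 5" "\<rho> 4 = 2" "\<rho> 5 = 4"
    by (simp_all add: \<rho>_def)
  \<comment> \<open>For each of these five pairs, one of the orders has a single label between the
    ends, which would be its own partner.\<close>
  have n13: "\<not> E 1 3" using id_partner[of 1 3 2] irrefl unfolding five by auto
  have n24: "\<not> E 2 4" using id_partner[of 2 4 3] irrefl unfolding five by auto
  have n35: "\<not> E 3 5" using id_partner[of 3 5 4] irrefl unfolding five by auto
  have n12: "\<not> E 2 1" using pos_partner[of 2 1 4] irrefl unfolding five by (auto simp: \<rho>)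
  have n45: "\<not> E 4 5" using pos_partner[of 4 5 1] irrefl unfolding five by (auto simp: \<rho>)
  \<comment> \<open>Three labels are enclosed, an odd number: both 2 and 4 would need the partner 3.
    For the pair 2, 3 in the order \<open>pos\<close>, likewise, both 4 and 5 would need 1.\<close>
  have n15: "\<not> E 1 5"
  proof
    assume E: "E 1 5"
    have "E 2 3" using id_partner[OF E, of 2] irrefl n24 unfolding five by auto
    moreover have "E 4 3" using id_partner[OF E, of 4] irrefl n24 sym unfolding five by auto
    ultimately show False using unique[of 3 2 4] sym by auto
  qed
  have n23: "\<not> E 2 3"
  proof
    assume E: "E 2 3"
    have "E 4 1" using pos_partner[OF E, of 4] irrefl n45 unfolding five by (auto simp: \<rho>)
    moreover have "E 5 1" using pos_partner[OF E, of 5] irrefl n45 sym unfolding five by (auto simp: \<rho>)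
    ultimately show False using unique[of 1 4 5] sym by auto
  qed
  \<comment> \<open>In the last three cases two labels are enclosed and would be partners, but their
    pair (1, 5, then 2, 3, then 1, 4) is already excluded.\<close>
  have n34: "\<not> E 4 3" using pos_partner[of 4 3 1] irrefl n15 unfolding five by (auto simp: \<rho>)
  have n14: "\<not> E 1 4" using id_partner[of 1 4 2] irrefl n23 unfolding five by auto
  have n25: "\<not> E 2 5" using pos_partner[of 2 5 4] irrefl n14 sym unfolding five by (auto simp: \<rho>)
  have "\<not> E r s" if "r \<in> {1..5}" "s \<in> {1..5}" for r s
    using that n13 n24 n35 n12 n45 n15 n23 n34 n14 n25 irrefl sym unfolding five by (auto; metis)
  moreover have "x - 5 * i \<in> {1..5}" "y - 5 * i \<in> {1..5}"
    using xy by auto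
  ultimately have "\<not> E (x - 5 * i) (y - 5 * i)"
    by blast
  then show ?thesis
    using xy unfolding E_def by simp
qed

section \<open>An unmatched label in every block, and the upper bound\<close>

lemma no_matched_block:
  assumes M: "matching n M" "noninterleaving id M" "noninterleaving pos M" and n: "n = 5 * k"
  shows "\<exists>x\<ge>1. block x = i \<and> x \<notin> \<Union>M"
proof (rule ccontr)
  assume contr: "\<not> ?thesis"
  have full: "\<exists>y. {x, y} \<in> M" if x: "5 * i < x" "x \<le> 5 * i + 5" for x
  proof -
    obtain e where e: "e \<in> M" "x \<in> e"
      using contr block_eqI[OF x] x by auto
    then have "card e = 2" using M(1) unfolding matching_def by blast
    then obtain u v where "e = {u, v}" by (auto simp: card_2_iff)
    then show ?thesis using e by (metis insert_commute insert_iff singletonD)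
  qed
  obtain a1 a2 a3 a4 a5 where a: "{5 * i + 1, a1} \<in> M" "{5 * i + 2, a2} \<in> M" "{5 * i + 3, a3} \<in> M"
    "{5 * i + 4, a4} \<in> M" "{5 * i + 5, a5} \<in> M"
    using full[of "5 * i + 1"] full[of "5 * i + 2"] full[of "5 * i + 3"] full[of "5 * i + 4"]
      full[of "5 * i + 5"] by auto
  have ge1: "a1 \<ge> 1" "a2 \<ge> 1" "a3 \<ge> 1" "a4 \<ge> 1" "a5 \<ge> 1"
    using a matching_range[OF M(1)] by (meson atLeastAtMost_iff)+
  have out: "block v \<noteq> i" if "{5 * i + r, v} \<in> M" "r \<in> {1..5}" for r v
  proof
    assume "block v = i"
    moreover have "v \<ge> 1" using that matching_range[OF M(1)] by auto
    ultimately have "5 * i < v" "v \<le> 5 * i + 5"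
      using block_bounds by auto
    moreover have "5 * i < 5 * i + r" "5 * i + r \<le> 5 * i + 5"
      using that by auto
    ultimately show False
      using no_edge_inside_matched_block[OF M full] that(1) by blast
  qed
  \<comment> \<open>The circle is cut before block \<open>i\<close>; earlier blocks move on by
    \<open>k\<close> blocks, that is by \<open>n\<close> positions.\<close>
  define shift where "shift v = (if block v < i then k else 0)" for v
  have rev_id: "w + 5 * shift w < v + 5 * shift v"
    if "{5 * i + r, v} \<in> M" "{5 * i + s, w} \<in> M" "r < s" "r \<in> {1..5}" "s \<in> {1..5}" for r s v w
    using id_order.partners_reversed[OF M(1,2) n that(1,2) _ block_offset[OF that(4)]
        block_offset[OF that(5)] out[OF that(1,4)] out[OF that(2,5)]] that(3) n
    by (simp add: shift_def split: if_splits)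
  have rev_pos: "pos w + 5 * shift w < pos v + 5 * shift v"
    if "{5 * i + r, v} \<in> M" "{5 * i + s, w} \<in> M" "pos (5 * i + r) < pos (5 * i + s)"
      "r \<in> {1..5}" "s \<in> {1..5}" for r s v w
    using pos_order.partners_reversed[OF M(1,3) n that(1-3) block_offset[OF that(4)]
        block_offset[OF that(5)] out[OF that(1,4)] out[OF that(2,5)]] n
    by (simp add: shift_def split: if_splits)
  \<comment> \<open>The block index after this cut; both orders traverse the blocks by increasing
    \<open>B\<close>.\<close>
  define B where "B v = block v + shift v" for v
  have bd: "5 * B v < v + 5 * shift v" "v + 5 * shift v \<le> 5 * B v + 5"
    "5 * B v < pos v + 5 * shift v" "pos v + 5 * shift v \<le> 5 * B v + 5" if "v \<ge> 1" for v
    using block_bounds[OF that] pos_bounds[OF that] by (simp_all add: B_def)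
  note bd = bd[OF ge1(1)] bd[OF ge1(2)] bd[OF ge1(3)] bd[OF ge1(4)] bd[OF ge1(5)]
  have id_chain: "a5 + 5 * shift a5 < a4 + 5 * shift a4" "a4 + 5 * shift a4 < a3 + 5 * shift a3"
    "a3 + 5 * shift a3 < a2 + 5 * shift a2" "a2 + 5 * shift a2 < a1 + 5 * shift a1"
    using rev_id[OF a(4,5)] rev_id[OF a(3,4)] rev_id[OF a(2,3)] rev_id[OF a(1,2)] by simp_all
  \<comment> \<open>By \<open>pos\<close> the offsets read 2, 4, 1, 5, 3, so their partners follow
    the reverse order 3, 5, 1, 4, 2.\<close>
  have pos_chain: "pos a3 + 5 * shift a3 < pos a5 + 5 * shift a5"
    "pos a5 + 5 * shift a5 < pos a1 + 5 * shift a1" "pos a1 + 5 * shift a1 < pos a4 + 5 * shift a4"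
    "pos a4 + 5 * shift a4 < pos a2 + 5 * shift a2"
    using rev_pos[OF a(5,3)] rev_pos[OF a(1,5)] rev_pos[OF a(4,1)] rev_pos[OF a(2,4)]
    unfolding pos_simps by simp_all
  \<comment> \<open>\<open>B\<close> is monotone along both chains, and together the inequalities
    close up into cycles through all five partners.\<close>
  have "B a5 \<le> B a4" "B a4 \<le> B a3" "B a3 \<le> B a2" "B a2 \<le> B a1" "B a3 \<le> B a5" "B a1 \<le> B a4"
    using bd id_chain pos_chain by linarith+
  then have B: "B a1 = B a2" "B a3 = B a2" "B a4 = B a2" "B a5 = B a2"
    by linarith+
  define j where "j = B a2"
  \<comment> \<open>Five strictly decreasing values fill the five places of one block, so
    \<open>a3\<close> has offset 3 and \<open>a5\<close> offset 1. But \<open>pos\<close> puts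
    offset 1 before offset 3, against \<open>pos_chain\<close>.\<close>
  have "a3 + 5 * shift a3 = 5 * j + 3" "a5 + 5 * shift a5 = 5 * j + 1"
    using bd id_chain B j_def by linarith+
  then have "a3 = 5 * block a3 + 3" "a5 = 5 * block a5 + 1"
    using B j_def by (simp_all add: B_def)
  then have "pos a3 = 5 * block a3 + 5" "pos a5 = 5 * block a5 + 3"
    using pos_simps(3,1) by metis+
  then have "pos a3 + 5 * shift a3 = 5 * j + 5" "pos a5 + 5 * shift a5 = 5 * j + 3"
    using B j_def by (simp_all add: B_def)
  then show False using pos_chain(1) by simp
qed

text \<open>One unmatched label in each of the \<open>k\<close> blocks leaves at most
  \<open>4 * k\<close> labels, and every edge takes two.\<close>

lemma matching_card_le:
  assumes M: "matching n M" "noninterleaving id M" "noninterleaving pos M" and n: "n = 5 * k"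
  shows "card M \<le> 2 * k"
proof -
  obtain u where u: "\<And>i. block (u i) = i" "\<And>i. u i \<ge> 1" "\<And>i. u i \<notin> \<Union>M"
    using no_matched_block[OF assms] by metis
  have edges: "e \<subseteq> {1..n}" "card e = 2" if "e \<in> M" for e
    using M(1) that unfolding matching_def by auto
  have "2 * card M = card (\<Union>M)"
  proof -
    have "card (\<Union>M) = sum card M"
      using M(1) edges by (intro card_Union_disjoint) (auto simp: matching_def intro: finite_subset)
    then show ?thesis using edges by simp
  qed
  also have "\<dots> \<le> card ({1..n} - u ` {..<k})"
    using edges u by (intro card_mono) auto
  also have "\<dots> = 4 * k"
  proof -
    have "inj_on u {..<k}" using u(1) by (metis inj_onI)
    moreover have "u ` {..<k} \<subseteq> {1..n}"
    proof safe
      fix i assume "i < k"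
      show "u i \<in> {1..n}"
        using u(1,2)[of i] block_bounds[of "u i"] n \<open>i < k\<close> by auto
    qed
    ultimately show ?thesis using n by (simp add: card_Diff_subset card_image)
  qed
  finally show ?thesis by simp
qed

subsection \<open>A large compatible matching\<close>

text \<open>Both edges of a block join consecutive labels, so the smaller end represents the
  edge.\<close>

definition edge_starts :: "nat \<Rightarrow> nat set" where
  "edge_starts k = (\<lambda>i. 5 * i + 2) ` {..<k} \<union> (\<lambda>i. 5 * i + 4) ` {..<k}"

definition block_edges :: "nat \<Rightarrow> nat set set" where
  "block_edges k = (\<lambda>x. {x, x + 1}) ` edge_starts k"

lemma edge_starts_cases:
  assumes "x \<in> edge_starts k"
  obtains i where "i < k" "x = 5 * i + 2" | i where "i < k" "x = 5 * i + 4"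
  using assms unfolding edge_starts_def by blast

lemma edge_starts_range:
  assumes "x \<in> edge_starts k"
  shows "x \<in> {1..5 * k}" "x + 1 \<in> {1..5 * k}"
  using assms by (auto elim!: edge_starts_cases)

lemma edge_starts_gap:
  assumes "x \<in> edge_starts k" "y \<in> edge_starts k" "x < y"
  shows "x + 1 < y"
proof -
  have "y \<noteq> x + 1"
    using assms(1,2) by (elim edge_starts_cases) presburger+
  then show ?thesis using assms(3) by simp
qed

text \<open>In the cyclic order given by \<open>pos\<close>, the second edge of a block is nested in the first one.\<close>

lemma edge_starts_pos:
  assumes "x \<in> edge_starts k" "y \<in> edge_starts k" "x < y"
  shows "pos y < pos (y + 1) \<and> (pos x < pos y \<or> pos (y + 1) < pos x)
    \<and> (pos (x + 1) < pos y \<or> pos (y + 1) < pos (x + 1))"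
proof -
  have block_edge: "\<exists>i. (x = 5 * i + 2 \<and> pos x = 5 * i + 1 \<and> pos (x + 1) = 5 * i + 5) \<or>
      (x = 5 * i + 4 \<and> pos x = 5 * i + 2 \<and> pos (x + 1) = 5 * i + 4)"
    if "x \<in> edge_starts k" for x
    using that
  proof (cases rule: edge_starts_cases)
    case (1 i)
    then have "x + 1 = 5 * i + 3" by simp
    then show ?thesis using 1 pos_simps by metis
  next
    case (2 i)
    then have "x + 1 = 5 * i + 5" by simp
    then show ?thesis using 2 pos_simps by metis
  qed
  obtain i where i: "(x = 5 * i + 2 \<and> pos x = 5 * i + 1 \<and> pos (x + 1) = 5 * i + 5) \<or>
      (x = 5 * i + 4 \<and> pos x = 5 * i + 2 \<and> pos (x + 1) = 5 * i + 4)"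
    using block_edge[OF assms(1)] by blast
  obtain j where j: "(y = 5 * j + 2 \<and> pos y = 5 * j + 1 \<and> pos (y + 1) = 5 * j + 5) \<or>
      (y = 5 * j + 4 \<and> pos y = 5 * j + 2 \<and> pos (y + 1) = 5 * j + 4)"
    using block_edge[OF assms(2)] by blast
  \<comment> \<open>Within one block, \<open>x < y\<close> makes \<open>y\<close> the start of the
    inner edge, so the ends of the other edge lie outside its span.\<close>
  show ?thesis using i j assms(3) by (elim disjE; elim conjE; simp only: ; arith)
qed

lemma matching_block_edges: "matching (5 * k) (block_edges k)"
  unfolding matching_def
proof (intro conjI ballI)
  fix e assume "e \<in> block_edges k"
  then show "e \<subseteq> {1..5 * k}" "card e = 2"
    using edge_starts_range unfolding block_edges_def by fastforce+
next
  have "disjnt {x, x + 1} {y, y + 1}" if "x \<in> edge_starts k" "y \<in> edge_starts k" "x \<noteq> y" for x y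
    using that edge_starts_gap[of x k y] edge_starts_gap[of y k x]
    by (cases "x < y") (auto simp: disjnt_def)
  then show "pairwise disjnt (block_edges k)"
    unfolding block_edges_def pairwise_def by auto
qed

lemma card_block_edges: "card (block_edges k) = 2 * k"
proof -
  have "inj_on (\<lambda>x. {x, x + 1}) (edge_starts k)"
    by (auto simp: inj_on_def doubleton_eq_iff)
  moreover have "card (edge_starts k) = 2 * k"
  proof -
    have "(\<lambda>i. 5 * i + 2) ` {..<k} \<inter> (\<lambda>i. 5 * i + 4) ` {..<k} = {}"
    proof safe
      fix i j :: nat
      assume "5 * i + 2 = 5 * j + 4"
      then have False by presburger
      then show "5 * i + 2 \<in> {}" ..
    qed
    moreover have "card ((\<lambda>i. 5 * i + c) ` {..<k}) = k" for c :: nat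
      by (simp add: card_image inj_on_def)
    ultimately show ?thesis
      unfolding edge_starts_def by (simp only: card_Un_disjoint finite_imageI finite_lessThan)
  qed
  ultimately show ?thesis
    unfolding block_edges_def by (simp add: card_image)
qed

text \<open>The later edge is named first because it is the one whose span avoids the ends of the
  other in both orders, as \<open>segments_disjoint_outside\<close> requires.\<close>

lemma crossing_free_block_edges:
  assumes disj: "\<And>x y. x \<in> edge_starts k \<Longrightarrow> y \<in> edge_starts k \<Longrightarrow> x < y \<Longrightarrow>
    closed_segment (p y) (p (y + 1)) \<inter> closed_segment (p x) (p (x + 1)) = {}"
  shows "crossing_free p (block_edges k)"
  unfolding crossing_free_def
proof (intro allI impI)
  fix a b c d
  assume *: "{a, b} \<in> block_edges k \<and> {c, d} \<in> block_edges k \<and> {a, b} \<noteq> {c, d}"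
  obtain x where x: "x \<in> edge_starts k" "{a, b} = {x, x + 1}"
    using * unfolding block_edges_def by blast
  obtain y where y: "y \<in> edge_starts k" "{c, d} = {y, y + 1}"
    using * unfolding block_edges_def by blast
  have "closed_segment (p a) (p b) = closed_segment (p x) (p (x + 1))"
    "closed_segment (p c) (p d) = closed_segment (p y) (p (y + 1))"
    using x(2) y(2) unfolding doubleton_eq_iff by (metis closed_segment_commute)+
  moreover have "x \<noteq> y" using * x y by auto
  then have "closed_segment (p x) (p (x + 1)) \<inter> closed_segment (p y) (p (y + 1)) = {}"
    using disj[OF x(1) y(1)] disj[OF y(1) x(1)] by (cases "x < y") (simp_all add: Int_commute)
  ultimately show "closed_segment (p a) (p b) \<inter> closed_segment (p c) (p d) \<subseteq> p ` ({a, b} \<inter> {c, d})"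
    by (simp only: empty_subsetI)
qed

theorem proposition1:
  fixes n k :: nat and \<pi> :: "nat \<Rightarrow> nat" and p q :: "nat \<Rightarrow> real^2"
  assumes "n = 5 * k" and "k \<ge> 2" and "even k"
    and "\<And>i. i < k \<Longrightarrow> \<pi> (5 * i + 1) = 5 * i + 2"
    and "\<And>i. i < k \<Longrightarrow> \<pi> (5 * i + 2) = 5 * i + 4"
    and "\<And>i. i < k \<Longrightarrow> \<pi> (5 * i + 3) = 5 * i + 1"
    and "\<And>i. i < k \<Longrightarrow> \<pi> (5 * i + 4) = 5 * i + 5"
    and "\<And>i. i < k \<Longrightarrow> \<pi> (5 * i + 5) = 5 * i + 3"
    and "clockwise_labeled_convex_set n id p"
    and "clockwise_labeled_convex_set n \<pi> q"
  shows "(\<exists>M. compatible_matching n {p, q} M \<and> real (card M) = 2 / 5 * real n) \<and>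
         (\<forall>M. compatible_matching n {p, q} M \<longrightarrow> real (card M) \<le> 2 / 5 * real n)"
proof -
  interpret P: labeled_convex_set n id p id
    by unfold_locales (use assms(9) in auto)
  interpret Q: labeled_convex_set n \<pi> q pos
  proof unfold_locales
    fix x assume x: "x \<in> {1..n}"
    then have ge1: "x \<ge> 1" by simp
    define i where "i = block x"
    have bd: "5 * i < x" "x \<le> 5 * i + 5"
      unfolding i_def using block_bounds[OF ge1] by auto
    \<comment> \<open>The values of \<open>\<pi>\<close> are prescribed only on blocks with index
      below \<open>k\<close>.\<close>
    then have i: "i < k" using x assms(1) by auto
    have "pos x \<in> {1..n}"
      using pos_bounds[OF ge1] i assms(1) unfolding i_def by auto
    moreover have "\<pi> (pos x) = x"
      using bd by (cases rule: offset_cases) (simp_all only: pos_simps assms(4-8)[OF i])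
    ultimately show "pos x \<in> {1..n} \<and> \<pi> (pos x) = x" ..
  qed (rule assms(10))
  have "crossing_free p (block_edges k)"
  proof (rule crossing_free_block_edges)
    fix x y assume xy: "x \<in> edge_starts k" "y \<in> edge_starts k" "x < y"
    show "closed_segment (p y) (p (y + 1)) \<inter> closed_segment (p x) (p (x + 1)) = {}"
      using edge_starts_gap[OF xy] edge_starts_range[OF xy(1)] edge_starts_range[OF xy(2)] assms(1)
      by (intro P.segments_disjoint_outside) auto
  qed
  moreover have "crossing_free q (block_edges k)"
  proof (rule crossing_free_block_edges)
    fix x y assume xy: "x \<in> edge_starts k" "y \<in> edge_starts k" "x < y"
    show "closed_segment (q y) (q (y + 1)) \<inter> closed_segment (q x) (q (x + 1)) = {}"
      using edge_starts_pos[OF xy] edge_starts_range[OF xy(1)] edge_starts_range[OF xy(2)] assms(1)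
      by (intro Q.segments_disjoint_outside) auto
  qed
  ultimately have "compatible_matching n {p, q} (block_edges k)"
    using matching_block_edges assms(1) by (simp add: compatible_matching_def)
  moreover have "card M \<le> 2 * k" if M: "compatible_matching n {p, q} M" for M
  proof -
    have cf: "matching n M" "crossing_free p M" "crossing_free q M"
      using M by (auto simp: compatible_matching_def)
    have "noninterleaving id M" "noninterleaving pos M"
      using P.crossing_free_no_interleaving[OF cf(2,1)] Q.crossing_free_no_interleaving[OF cf(3,1)]
      unfolding noninterleaving_def by blast+
    then show ?thesis
      using matching_card_le[OF cf(1)] assms(1) by blast
  qed
  ultimately show ?thesis
    using card_block_edges[of k] assms(1) by fastforce
qed

end
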